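(* Let $c\ge 1$ and $k\ge 2$ be fixed integers. For every $c$-closed graph $G$ on $n$ vertices that contains no clique on $k$ vertices: (1) the number of edges of $G$ is $O(n^{3/2})$; (2) for every fixed integer $j>2$, $n_{j+1}(G)=O\!\left(n_j(G)^{1/2}\, n\right)$, where the implied constants may depend on $c$, $k$ and $j$ but not on $n$ or $G$.
   Context: All graphs are finite, simple and undirected. For a positive integer $c$, a graph is $c$-closed if every two distinct vertices with at least $c$ common neighbors are adjacent. For a positive integer $j$, $n_j(G)$ denotes the number of (not necessarily maximal) cliques on exactly $j$ vertices in $G$. *)

theory Defs
  imports Complex_Main "HOL-Library.Ramsey"
begin

text \<open>
  A graph is a vertex set \<open>V\<close> with a set \<open>E\<close> of two-element subsets of \<open>V\<close>; the number of
  edges is then \<open>card E\<close>. The vertex type is left polymorphic: every finite graph is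
  isomorphic to one with vertices in \<^typ>\<open>nat\<close>, so a constant that works for that instance works
  for all finite graphs, and existence of a constant for each vertex type does not hide a
  dependence on the graph.
\<close>

definition finite_graph :: "'a set \<Rightarrow> 'a set set \<Rightarrow> bool"
  where "finite_graph V E \<longleftrightarrow> finite V \<and> E \<subseteq> [V]\<^bsup>2\<^esup>"

definition common_neighbors :: "'a set \<Rightarrow> 'a set set \<Rightarrow> 'a \<Rightarrow> 'a \<Rightarrow> 'a set"
  where "common_neighbors V E u v = {w \<in> V. {u, w} \<in> E \<and> {v, w} \<in> E}"

definition closed_graph :: "nat \<Rightarrow> 'a set \<Rightarrow> 'a set set \<Rightarrow> bool"
  where "closed_graph c V E \<longleftrightarrow>
    (\<forall>u\<in>V. \<forall>v\<in>V. u \<noteq> v \<longrightarrow> c \<le> card (common_neighbors V E u v) \<longrightarrow> {u, v} \<in> E)"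

definition cliques_of_size :: "'a set \<Rightarrow> 'a set set \<Rightarrow> nat \<Rightarrow> 'a set set"
  where "cliques_of_size V E j = {K \<in> [V]\<^bsup>j\<^esup>. clique K E}"

definition num_cliques :: "'a set \<Rightarrow> 'a set set \<Rightarrow> nat \<Rightarrow> nat"
  where "num_cliques V E j = card (cliques_of_size V E j)"

end

theory Submission
  imports Defs "HOL-Analysis.Convex"
begin

text \<open>
  For a \<open>j\<close>-clique \<open>K\<close> let \<open>d K\<close> be the number of vertices extending it to a \<open>(j + 1)\<close>-clique.
  These vertices span a graph without a \<open>k\<close>-clique, so a positive proportion of the pairs of
  them is non-adjacent. A non-adjacent pair has fewer than \<open>c\<close> common neighbours, hence arises
  from at most \<open>2 ^ c\<close> cliques \<open>K\<close>. Therefore the sum of \<open>(d K)\<^sup>2\<close> over all \<open>K\<close> is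
  \<open>O(n\<^sup>2 + n\<^sub>j)\<close>, where \<open>n\<^sub>j\<close> absorbs the degenerate pairs \<open>(x, x)\<close>. As \<open>d K \<le> (d K)\<^sup>2\<close>, induction
  gives \<open>n\<^sub>j = O(n\<^sup>2)\<close>, and Cauchy--Schwarz then bounds the sum of \<open>d K\<close>, which is at least
  \<open>n\<^bsub>j+1\<^esub>\<close>. The number of edges is the case \<open>j = 1\<close>.
\<close>

section \<open>Clique extensions and the density of non-adjacent pairs\<close>

definition clique_extensions :: "'a set \<Rightarrow> 'a set set \<Rightarrow> 'a set \<Rightarrow> 'a set"
  where "clique_extensions V E K = {v \<in> V - K. \<forall>w\<in>K. {w, v} \<in> E}"

text \<open>Pairs are ordered, and without loops the diagonal belongs to the set, because
  \<open>{x, x}\<close> is a singleton. Hence even a clique \<open>S\<close> has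
  \<open>card S\<close> such pairs, which lets a quadratic lower bound hold without an error
  term.\<close>

definition nonadjacent_pairs :: "'a set \<Rightarrow> 'a set set \<Rightarrow> ('a \<times> 'a) set"
  where "nonadjacent_pairs S E = {(x, y) \<in> S \<times> S. {x, y} \<notin> E}"

lemma finite_nonadjacent_pairs: "finite S \<Longrightarrow> finite (nonadjacent_pairs S E)"
  unfolding nonadjacent_pairs_def by (rule finite_subset[of _ "S \<times> S"]) auto

lemma finite_clique_extensions: "finite V \<Longrightarrow> finite (clique_extensions V E K)"
  unfolding clique_extensions_def by auto

lemma finite_cliques_of_size: "finite V \<Longrightarrow> finite (cliques_of_size V E j)"
  unfolding cliques_of_size_def nsets_def by simp

lemma clique_card_less:
  assumes "cliques_of_size V E k = {}" "K \<subseteq> V" "finite K" "clique K E"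
  shows "card K < k"
proof (rule ccontr)
  assume "\<not> card K < k"
  then obtain L where "L \<subseteq> K" "card L = k"
    using obtain_subset_with_card_n[of k K] by (metis not_less)
  then have "L \<in> cliques_of_size V E k"
    using assms(2-4) unfolding cliques_of_size_def nsets_def clique_def
    by (auto intro: finite_subset)
  with assms(1) show False by simp
qed

text \<open>Take an inclusion-maximal clique in \<open>S\<close>. Each vertex of \<open>S\<close> is
  non-adjacent to some member of it: an outside vertex by maximality, a member to itself for lack of
  loops. So at most \<open>k\<close> sets of non-neighbours cover \<open>S\<close>, and one of them
  is large.\<close>

lemma ex_vertex_many_nonneighbors:
  assumes "finite S" "S \<noteq> {}" "\<And>x. {x} \<notin> E"
    and bound: "\<And>K. K \<subseteq> S \<Longrightarrow> clique K E \<Longrightarrow> card K \<le> k"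
  shows "\<exists>y\<in>S. card S \<le> k * card {x \<in> S. {y, x} \<notin> E}"
proof -
  define N where "N y = {x \<in> S. {y, x} \<notin> E}" for y
  obtain K where K: "K \<subseteq> S" "clique K E"
    and max: "\<And>L. L \<subseteq> S \<Longrightarrow> clique L E \<Longrightarrow> K \<subseteq> L \<Longrightarrow> L = K"
  proof -
    have "finite {K. K \<subseteq> S \<and> clique K E}" using assms(1) by simp
    moreover have "{} \<in> {K. K \<subseteq> S \<and> clique K E}" by (simp add: clique_def)
    ultimately obtain K where "K \<in> {K. K \<subseteq> S \<and> clique K E}"
      "\<forall>L\<in>{K. K \<subseteq> S \<and> clique K E}. K \<subseteq> L \<longrightarrow> K = L"
      using finite_has_maximal[of "{K. K \<subseteq> S \<and> clique K E}"] by blast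
    then show thesis by (intro that[of K]) auto
  qed
  have finK: "finite K" using K(1) assms(1) by (rule finite_subset)
  have cover: "S \<subseteq> (\<Union>y\<in>K. N y)"
  proof
    fix x assume x: "x \<in> S"
    have "\<exists>y\<in>K. {y, x} \<notin> E"
    proof (cases "x \<in> K")
      case True
      then show ?thesis using assms(3)[of x] by (intro bexI[of _ x]) auto
    next
      case False
      then have "\<not> clique (insert x K) E" using max[of "insert x K"] x K by auto
      then show ?thesis using K(2) unfolding clique_def
        by (metis insert_iff insert_commute)
    qed
    then show "x \<in> (\<Union>y\<in>K. N y)" using x by (auto simp: N_def)
  qed
  have "\<exists>y\<in>K. card S \<le> k * card (N y)"
  proof (rule ccontr)
    assume neg: "\<not> ?thesis"
    have "K \<noteq> {}" using cover assms(2) by auto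
    have "card S \<le> card (\<Union>y\<in>K. N y)"
      by (rule card_mono[OF _ cover]) (simp add: finK N_def assms(1))
    also have "\<dots> \<le> (\<Sum>y\<in>K. card (N y))" by (rule card_UN_le[OF finK])
    \<comment> \<open>Scaling by \<open>k\<close> makes the negated claim apply to each summand;
      since \<open>K\<close> is nonempty, the sum inherits the strict inequality.\<close>
    finally have "k * card S \<le> (\<Sum>y\<in>K. k * card (N y))"
      by (simp flip: sum_distrib_left)
    also have "\<dots> < (\<Sum>y\<in>K. card S)"
      by (rule sum_strict_mono) (use finK \<open>K \<noteq> {}\<close> neg in auto)
    also have "\<dots> = card K * card S" by simp
    also have "\<dots> \<le> k * card S" using bound[OF K] by (rule mult_right_mono) simp
    finally show False by simp
  qed
  then show ?thesis using K(1) unfolding N_def by blast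
qed

text \<open>A weak form of Turan's theorem for the complement, by deleting a vertex \<open>y\<close>
  with many non-neighbours: the pairs with first entry \<open>y\<close> alone number at least
  \<open>card S / k\<close> when \<open>k\<close> is positive.\<close>

lemma card_nonadjacent_pairs_ge:
  assumes "finite S" "\<And>x. {x} \<notin> E"
    and "\<And>K. K \<subseteq> S \<Longrightarrow> clique K E \<Longrightarrow> card K \<le> k"
  shows "(card S)\<^sup>2 \<le> 2 * k * card (nonadjacent_pairs S E)"
  using assms
proof (induction "card S" arbitrary: S)
  case 0
  then show ?case by simp
next
  case (Suc s)
  then have "S \<noteq> {}" by auto
  then obtain y where y: "y \<in> S" "card S \<le> k * card {x \<in> S. {y, x} \<notin> E}"
    using ex_vertex_many_nonneighbors[of S E k] Suc.prems by blast
  let ?N = "{x \<in> S. {y, x} \<notin> E}" and ?P = "nonadjacent_pairs (S - {y}) E"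
  have s: "card (S - {y}) = s" using Suc.hyps(2) Suc.prems(1) y(1) by simp
  have IH: "s\<^sup>2 \<le> 2 * k * card ?P"
    using Suc.hyps(1)[of "S - {y}"] Suc.prems s by (metis Diff_subset finite_Diff order_trans)
  have finP: "finite ?P" using Suc.prems(1) by (intro finite_nonadjacent_pairs) simp
  have "card (?P \<union> {y} \<times> ?N) = card ?P + card ({y} \<times> ?N)"
    by (rule card_Un_disjoint) (use Suc.prems(1) finP in \<open>auto simp: nonadjacent_pairs_def\<close>)
  also have "card ({y} \<times> ?N) = card ?N" by (simp add: card_cartesian_product)
  finally have "card ?P + card ?N = card (?P \<union> {y} \<times> ?N)" by simp
  also have "\<dots> \<le> card (nonadjacent_pairs S E)"
    by (intro card_mono finite_nonadjacent_pairs Suc.prems(1))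
      (use y(1) in \<open>auto simp: nonadjacent_pairs_def\<close>)
  finally have "2 * k * (card ?P + card ?N) \<le> 2 * k * card (nonadjacent_pairs S E)"
    by (rule mult_left_mono) simp
  \<comment> \<open>Passing from \<open>s\<close> to \<open>s + 1\<close> raises the square by
    \<open>2 * s + 1\<close>, at most \<open>2 * card S\<close>; this is the origin of the factor 2
    in the bound.\<close>
  moreover have "(card S)\<^sup>2 \<le> s\<^sup>2 + 2 * card S"
    unfolding Suc.hyps(2)[symmetric] by (simp add: power2_eq_square)
  ultimately show ?case using IH y(2) by (simp add: algebra_simps)
qed

section \<open>Counting clique extensions\<close>

lemma num_cliques_Suc_le:
  assumes "finite V"
  shows "num_cliques V E (Suc j) \<le> (\<Sum>K\<in>cliques_of_size V E j. card (clique_extensions V E K))"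
proof -
  let ?S = "Sigma (cliques_of_size V E j) (clique_extensions V E)"
  have fin: "finite ?S"
    by (intro finite_SigmaI finite_cliques_of_size finite_clique_extensions assms)
  \<comment> \<open>Removing any one vertex exhibits a larger clique as an extension. The map hits
    each clique several times, but surjectivity is enough for an upper bound.\<close>
  have "cliques_of_size V E (Suc j) \<subseteq> (\<lambda>(K, v). insert v K) ` ?S"
  proof
    fix L assume L: "L \<in> cliques_of_size V E (Suc j)"
    then obtain v where v: "v \<in> L" unfolding cliques_of_size_def nsets_def by fastforce
    then have "(L - {v}, v) \<in> ?S" "insert v (L - {v}) = L"
      using L unfolding cliques_of_size_def nsets_def clique_extensions_def clique_def by auto
    then show "L \<in> (\<lambda>(K, v). insert v K) ` ?S"
      by (metis (no_types, lifting) case_prod_conv image_eqI)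
  qed
  then have "num_cliques V E (Suc j) \<le> card ?S"
    unfolding num_cliques_def by (rule surj_card_le[OF fin])
  also have "\<dots> = (\<Sum>K\<in>cliques_of_size V E j. card (clique_extensions V E K))"
    by (rule card_SigmaI) (simp_all add: finite_cliques_of_size finite_clique_extensions assms)
  finally show ?thesis .
qed

text \<open>Double counting of incidences between cliques and pairs. The diagonal is split off,
  since closedness concerns distinct vertices only; it yields the second summand.\<close>

lemma sum_nonadjacent_pairs_extensions_le:
  assumes "finite V" "closed_graph c V E"
  shows "(\<Sum>K\<in>cliques_of_size V E j. card (nonadjacent_pairs (clique_extensions V E K) E))
    \<le> 2 ^ c * (card V)\<^sup>2 + (\<Sum>K\<in>cliques_of_size V E j. card (clique_extensions V E K))"
proof -
  let ?C = "cliques_of_size V E j" and ?X = "clique_extensions V E"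
  define D where "D = {(u, v) \<in> V \<times> V. u \<noteq> v \<and> {u, v} \<notin> E}"
  define R where "R K p \<longleftrightarrow> fst p \<in> ?X K \<and> snd p \<in> ?X K" for K p
  have finC: "finite ?C" by (rule finite_cliques_of_size[OF assms(1)])
  have finD: "finite D" unfolding D_def
    by (rule finite_subset[of _ "V \<times> V"]) (use assms(1) in auto)
  have pair: "card {K \<in> ?C. R K p} \<le> 2 ^ c" if "p \<in> D" for p :: "'a \<times> 'a"
  proof -
    obtain u v where p: "p = (u, v)" "u \<in> V" "v \<in> V" "u \<noteq> v" "{u, v} \<notin> E"
      using \<open>p \<in> D\<close> unfolding D_def by auto
    let ?N = "common_neighbors V E u v"
    have "finite ?N" unfolding common_neighbors_def using assms(1) by simp
    \<comment> \<open>If \<open>u\<close> and \<open>v\<close> both extend \<open>K\<close>, every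
      vertex of \<open>K\<close> is a common neighbour of them. Counting all subsets of the common
      neighbourhood gives a bound independent of \<open>j\<close>.\<close>
    have "{K \<in> ?C. R K p} \<subseteq> Pow ?N"
      unfolding R_def p(1) cliques_of_size_def nsets_def clique_extensions_def common_neighbors_def
      by (auto simp: insert_commute)
    then have "card {K \<in> ?C. R K p} \<le> card (Pow ?N)"
      using \<open>finite ?N\<close> by (intro card_mono) simp_all
    also have "\<dots> = 2 ^ card ?N" by (rule card_Pow[OF \<open>finite ?N\<close>])
    also have "\<dots> \<le> 2 ^ c"
    proof (rule power_increasing)
      show "card ?N \<le> c"
        using assms(2) p unfolding closed_graph_def by (metis nat_le_linear)
    qed simp
    finally show ?thesis .
  qed
  have "card (nonadjacent_pairs (?X K) E) \<le> card {p \<in> D. R K p} + card (?X K)" for K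
  proof -
    have "nonadjacent_pairs (?X K) E \<subseteq> {p \<in> D. R K p} \<union> (\<lambda>x. (x, x)) ` ?X K"
      unfolding nonadjacent_pairs_def D_def R_def by (auto simp: clique_extensions_def)
    then have "card (nonadjacent_pairs (?X K) E) \<le> card ({p \<in> D. R K p} \<union> (\<lambda>x. (x, x)) ` ?X K)"
      by (rule card_mono[rotated]) (simp add: finD finite_clique_extensions assms(1))
    also have "\<dots> \<le> card {p \<in> D. R K p} + card ((\<lambda>x. (x, x)) ` ?X K)" by (rule card_Un_le)
    also have "card ((\<lambda>x. (x, x)) ` ?X K) = card (?X K)" by (rule card_image) (simp add: inj_on_def)
    finally show ?thesis by simp
  qed
  then have "(\<Sum>K\<in>?C. card (nonadjacent_pairs (?X K) E))
      \<le> (\<Sum>K\<in>?C. card {p \<in> D. R K p} + card (?X K))"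
    by (intro sum_mono) auto
  also have "\<dots> = (\<Sum>K\<in>?C. card {p \<in> D. R K p}) + (\<Sum>K\<in>?C. card (?X K))"
    by (rule sum.distrib)
  also have "(\<Sum>K\<in>?C. card {p \<in> D. R K p}) = (\<Sum>p\<in>D. card {K \<in> ?C. R K p})"
    using sum.swap_restrict[OF finC finD, of "\<lambda>_ _. 1::nat" R] by simp
  also have "\<dots> \<le> card D * 2 ^ c" using sum_bounded_above[OF pair, of D] by simp
  also have "card D \<le> (card V)\<^sup>2"
  proof -
    have "card D \<le> card (V \<times> V)"
      by (rule card_mono) (use assms(1) in \<open>auto simp: D_def\<close>)
    then show ?thesis by (simp add: card_cartesian_product power2_eq_square)
  qed
  finally show ?thesis by (simp add: mult.commute)
qed

lemma sum_extensions_squared_le: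
  assumes "finite_graph V E" "closed_graph c V E" "cliques_of_size V E k = {}"
  shows "(\<Sum>K\<in>cliques_of_size V E j. (card (clique_extensions V E K))\<^sup>2)
    \<le> 4 * k * 2 ^ c * (card V)\<^sup>2 + 4 * k\<^sup>2 * num_cliques V E j"
proof -
  have fin: "finite V" and loop: "{x} \<notin> E" for x
    using assms(1) unfolding finite_graph_def nsets_def by auto
  let ?C = "cliques_of_size V E j" and ?X = "clique_extensions V E"
  have "(card (?X K))\<^sup>2 \<le> 2 * k * card (nonadjacent_pairs (?X K) E)" for K
  proof (rule card_nonadjacent_pairs_ge[OF finite_clique_extensions[OF fin] loop])
    fix L assume L: "L \<subseteq> ?X K" "clique L E"
    then have "L \<subseteq> V" unfolding clique_extensions_def by blast
    then have "card L < k"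
      using clique_card_less[OF assms(3)] L(2) fin finite_subset by blast
    then show "card L \<le> k" by simp
  qed
  then have "(\<Sum>K\<in>?C. (card (?X K))\<^sup>2) \<le> 2 * k * (\<Sum>K\<in>?C. card (nonadjacent_pairs (?X K) E))"
    unfolding sum_distrib_left by (intro sum_mono) auto
  also have "\<dots> \<le> 2 * k * (2 ^ c * (card V)\<^sup>2 + (\<Sum>K\<in>?C. card (?X K)))"
    by (intro mult_left_mono sum_nonadjacent_pairs_extensions_le[OF fin assms(2)]) simp
  \<comment> \<open>The inequality is doubled so that one copy of the sum of squares can absorb the
    linear term while another survives on the left.\<close>
  finally have main: "2 * (\<Sum>K\<in>?C. (card (?X K))\<^sup>2)
      \<le> 4 * k * 2 ^ c * (card V)\<^sup>2 + 4 * k * (\<Sum>K\<in>?C. card (?X K))"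
    by (simp add: algebra_simps)
  \<comment> \<open>The square is taken over the integers because subtraction on \<open>nat\<close>
    truncates.\<close>
  have amgm: "4 * k * d \<le> d\<^sup>2 + 4 * k\<^sup>2" for d :: nat
  proof -
    have "0 \<le> (int d - 2 * int k)\<^sup>2" by simp
    then have "int (4 * k * d) \<le> int (d\<^sup>2 + 4 * k\<^sup>2)"
      by (simp add: power2_eq_square algebra_simps)
    then show ?thesis by linarith
  qed
  have "4 * k * (\<Sum>K\<in>?C. card (?X K)) \<le> (\<Sum>K\<in>?C. (card (?X K))\<^sup>2 + 4 * k\<^sup>2)"
    unfolding sum_distrib_left by (intro sum_mono amgm)
  also have "\<dots> = (\<Sum>K\<in>?C. (card (?X K))\<^sup>2) + 4 * k\<^sup>2 * num_cliques V E j"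
    unfolding sum.distrib num_cliques_def by simp
  finally show ?thesis using main by linarith
qed

section \<open>Bounds on the numbers of cliques\<close>

lemma num_cliques_1_le:
  assumes "finite V"
  shows "num_cliques V E 1 \<le> card V"
proof -
  have "cliques_of_size V E 1 \<subseteq> (\<lambda>v. {v}) ` V"
    unfolding cliques_of_size_def nsets_def by (auto simp: card_1_singleton_iff)
  then show ?thesis unfolding num_cliques_def by (rule surj_card_le[OF assms])
qed

lemma card_edges_le_num_cliques_2:
  assumes "finite_graph V E"
  shows "card E \<le> num_cliques V E 2"
proof -
  have "E \<subseteq> cliques_of_size V E 2"
  proof
    fix e assume e: "e \<in> E"
    then have "e \<in> [V]\<^bsup>2\<^esup>" using assms unfolding finite_graph_def by blast
    moreover from this have "clique e E"
      using e unfolding nsets_def clique_def by (auto simp: card_2_iff insert_commute)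
    ultimately show "e \<in> cliques_of_size V E 2" unfolding cliques_of_size_def by blast
  qed
  then show ?thesis unfolding num_cliques_def
    using assms by (intro card_mono finite_cliques_of_size) (auto simp: finite_graph_def)
qed

text \<open>This serves to absorb the clique term of \<open>sum_extensions_squared_le\<close> into
  the quadratic one. The shift to \<open>Suc j\<close> avoids the empty clique: in the empty graph
  its count 1 exceeds \<open>B * 0\<close>.\<close>

lemma num_cliques_quadratic:
  "\<exists>B. \<forall>(V::'a set) (E::'a set set). finite_graph V E \<longrightarrow> closed_graph c V E \<longrightarrow>
     cliques_of_size V E k = {} \<longrightarrow> num_cliques V E (Suc j) \<le> B * (card V)\<^sup>2"
proof (induction j)
  case 0
  have "num_cliques V E (Suc 0) \<le> 1 * (card V)\<^sup>2" if "finite_graph V E"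
    for V :: "'a set" and E
    using num_cliques_1_le[of V E] that
    by (auto simp: finite_graph_def power2_eq_square intro: order_trans[OF _ le_square])
  then show ?case by blast
next
  case (Suc j)
  then obtain B where B: "\<And>(V::'a set) (E::'a set set). finite_graph V E \<Longrightarrow> closed_graph c V E \<Longrightarrow>
     cliques_of_size V E k = {} \<Longrightarrow> num_cliques V E (Suc j) \<le> B * (card V)\<^sup>2"
    by blast
  have "num_cliques V E (Suc (Suc j)) \<le> (4 * k * 2 ^ c + 4 * k\<^sup>2 * B) * (card V)\<^sup>2"
    if G: "finite_graph V E" "closed_graph c V E" "cliques_of_size V E k = {}"
    for V :: "'a set" and E
  proof -
    let ?C = "cliques_of_size V E (Suc j)" and ?d = "\<lambda>K. card (clique_extensions V E K)"
    have "num_cliques V E (Suc (Suc j)) \<le> (\<Sum>K\<in>?C. ?d K)"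
      using G(1) by (intro num_cliques_Suc_le) (simp add: finite_graph_def)
    also have "\<dots> \<le> (\<Sum>K\<in>?C. (?d K)\<^sup>2)"
      by (intro sum_mono) (simp add: power2_eq_square)
    also have "\<dots> \<le> 4 * k * 2 ^ c * (card V)\<^sup>2 + 4 * k\<^sup>2 * num_cliques V E (Suc j)"
      by (rule sum_extensions_squared_le[OF G])
    also have "\<dots> \<le> 4 * k * 2 ^ c * (card V)\<^sup>2 + 4 * k\<^sup>2 * (B * (card V)\<^sup>2)"
      by (intro add_left_mono mult_left_mono B[OF G]) simp
    finally show ?thesis by (simp add: algebra_simps)
  qed
  then show ?case by blast
qed

lemma num_cliques_Suc_le_sqrt:
  assumes "0 < j"
  shows "\<exists>C::real. \<forall>(V::'a set) (E::'a set set). finite_graph V E \<longrightarrow> closed_graph c V E \<longrightarrow>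
     cliques_of_size V E k = {} \<longrightarrow>
     real (num_cliques V E (Suc j)) \<le> C * (sqrt (real (num_cliques V E j)) * real (card V))"
proof -
  obtain i where "j = Suc i" using assms gr0_implies_Suc by blast
  then obtain B where B: "\<And>(V::'a set) (E::'a set set). finite_graph V E \<Longrightarrow> closed_graph c V E \<Longrightarrow>
     cliques_of_size V E k = {} \<Longrightarrow> num_cliques V E j \<le> B * (card V)\<^sup>2"
    using num_cliques_quadratic[of c k i] by blast
  \<comment> \<open>Both terms of \<open>sum_extensions_squared_le\<close>, with the number of
    \<open>j\<close>-cliques replaced by \<open>B * (card V)\<^sup>2\<close>.\<close>
  define A where "A = 4 * k * 2 ^ c + 4 * k\<^sup>2 * B"
  have "real (num_cliques V E (Suc j))
      \<le> sqrt (real A) * (sqrt (real (num_cliques V E j)) * real (card V))"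
    if G: "finite_graph V E" "closed_graph c V E" "cliques_of_size V E k = {}"
    for V :: "'a set" and E
  proof -
    let ?C = "cliques_of_size V E j" and ?d = "\<lambda>K. card (clique_extensions V E K)"
    have sq: "(\<Sum>K\<in>?C. (?d K)\<^sup>2) \<le> A * (card V)\<^sup>2"
    proof -
      note sum_extensions_squared_le[OF G, of j]
      also have "4 * k * 2 ^ c * (card V)\<^sup>2 + 4 * k\<^sup>2 * num_cliques V E j
          \<le> 4 * k * 2 ^ c * (card V)\<^sup>2 + 4 * k\<^sup>2 * (B * (card V)\<^sup>2)"
        by (intro add_left_mono mult_left_mono B[OF G]) simp
      finally show ?thesis by (simp add: A_def algebra_simps)
    qed
    have "num_cliques V E (Suc j) \<le> (\<Sum>K\<in>?C. ?d K)"
      using G(1) by (intro num_cliques_Suc_le) (simp add: finite_graph_def)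
    then have "real (num_cliques V E (Suc j)) \<le> (\<Sum>K\<in>?C. real (?d K))"
      by (simp flip: of_nat_sum)
    then have "(real (num_cliques V E (Suc j)))\<^sup>2 \<le> (\<Sum>K\<in>?C. real (?d K))\<^sup>2"
      by (rule power_mono) simp
    also have "\<dots> \<le> real (card ?C) * (\<Sum>K\<in>?C. (real (?d K))\<^sup>2)"
      using sum_squared_le_sum_of_squares[of "\<lambda>K. real (?d K)" ?C]
      by (simp add: mult.commute)
    also have "\<dots> = real (num_cliques V E j) * real (\<Sum>K\<in>?C. (?d K)\<^sup>2)"
      by (simp add: num_cliques_def)
    also have "\<dots> \<le> real (num_cliques V E j) * real (A * (card V)\<^sup>2)"
      using sq by (intro mult_left_mono) (simp_all only: of_nat_le_iff of_nat_0_le_iff)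
    finally have "real (num_cliques V E (Suc j))
        \<le> sqrt (real (num_cliques V E j) * real (A * (card V)\<^sup>2))"
      by (rule real_le_rsqrt)
    also have "\<dots> = sqrt (real A) * (sqrt (real (num_cliques V E j)) * real (card V))"
      by (simp add: real_sqrt_mult)
    finally show ?thesis .
  qed
  then show ?thesis by blast
qed

theorem theoremD1:
  fixes c k :: nat
  assumes "c \<ge> 1" and "k \<ge> 2"
  shows
    "(\<exists>C::real. \<forall>(V::'a set) (E::'a set set).
        finite_graph V E \<longrightarrow> closed_graph c V E \<longrightarrow> cliques_of_size V E k = {} \<longrightarrow>
          real (card E) \<le> C * real (card V) powr (3/2))
     \<and>
     (\<forall>j>2. \<exists>C::real. \<forall>(V::'a set) (E::'a set set).
        finite_graph V E \<longrightarrow> closed_graph c V E \<longrightarrow> cliques_of_size V E k = {} \<longrightarrow>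
          real (num_cliques V E (j + 1)) \<le> C * (sqrt (real (num_cliques V E j)) * real (card V)))"
proof (intro conjI allI impI)
  obtain C :: real where C: "\<And>(V::'a set) (E::'a set set). finite_graph V E \<Longrightarrow>
     closed_graph c V E \<Longrightarrow> cliques_of_size V E k = {} \<Longrightarrow>
     real (num_cliques V E 2) \<le> C * (sqrt (real (num_cliques V E 1)) * real (card V))"
    using num_cliques_Suc_le_sqrt[of 1 c k] by (auto simp: numeral_2_eq_2)
  have "real (card E) \<le> \<bar>C\<bar> * real (card V) powr (3/2)"
    if G: "finite_graph V E" "closed_graph c V E" "cliques_of_size V E k = {}"
    for V :: "'a set" and E
  proof -
    have "real (card E) \<le> real (num_cliques V E 2)"
      using card_edges_le_num_cliques_2[OF G(1)] by simp
    also have "\<dots> \<le> C * (sqrt (real (num_cliques V E 1)) * real (card V))" by (rule C[OF G])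
    \<comment> \<open>The sign of \<open>C\<close> is unknown; a nonnegative factor is needed for
      the monotonicity step that replaces the number of 1-cliques by \<open>card V\<close>.\<close>
    also have "\<dots> \<le> \<bar>C\<bar> * (sqrt (real (num_cliques V E 1)) * real (card V))"
      by (rule mult_right_mono) simp_all
    also have "\<dots> \<le> \<bar>C\<bar> * (sqrt (real (card V)) * real (card V))"
      using num_cliques_1_le[of V E] G(1)
      by (intro mult_left_mono mult_right_mono) (simp_all add: finite_graph_def)
    also have "sqrt (real (card V)) * real (card V) = real (card V) powr (1/2 + 1)"
      unfolding powr_add by (simp add: powr_half_sqrt)
    finally show ?thesis by simp
  qed
  then show "\<exists>C::real. \<forall>(V::'a set) (E::'a set set).
        finite_graph V E \<longrightarrow> closed_graph c V E \<longrightarrow> cliques_of_size V E k = {} \<longrightarrow>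
          real (card E) \<le> C * real (card V) powr (3/2)"
    by blast
next
  fix j :: nat assume "j > 2"
  then show "\<exists>C::real. \<forall>(V::'a set) (E::'a set set).
        finite_graph V E \<longrightarrow> closed_graph c V E \<longrightarrow> cliques_of_size V E k = {} \<longrightarrow>
          real (num_cliques V E (j + 1)) \<le> C * (sqrt (real (num_cliques V E j)) * real (card V))"
    using num_cliques_Suc_le_sqrt[of j c k] by simp
qed

end
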